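(* Fix $\theta\in(0,\infty)$ and $k\ge 1$. For each pair-matched word $w\in\mathcal{W}_{2k}^{(p)}$, the limit $p_\theta(w):=\lim_{n\to\infty} n^{-(k+1)}\,\#\Pi_\theta^*(w)$ exists and $$p_\theta(w)=\sum_{\gamma\in\mathcal{A}_\theta^k}\theta^{-k-1}\underbrace{\int_0^\theta\cdots\int_0^\theta}_{k+1\text{ fold}}\mathbb{I}\big(L_i^H(\nu_{S(w)})+a_i^{(\gamma)}\in(0,\theta)\text{ for all } i\in\{0,\dots,2k\}\setminus (S(w)\cup\{2k\})\big)\,\mathbb{I}\big(\nu_0=L_{2k}^H(\nu_{S(w)})+a_{2k}^{(\gamma)}\big)\,d\nu_{S(w)},$$ where $\mathcal{A}_\theta=\{0,\pm1,\dots,\pm\lfloor 2\theta\rfloor\}$, the $a_i^{(\gamma)}$ ($i\notin S(w)$) are the constants depending on $\gamma$ (and on $w$), and the $L_i^H$ ($i\notin S(w)$) are the linear functions of the variables $\nu_{S(w)}=\{\nu_i:i\in S(w)\}$, specified in the context.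
   Context: $\lfloor a\rfloor$ denotes the greatest integer $\le a$, and $\mathbb{I}$ denotes an indicator function. For $n$ large enough that $\lfloor n/\theta\rfloor\ge 1$, define the link function $L_\theta(i,j)=(i+j) \bmod \lfloor n/\theta\rfloor$ for $1\le i,j\le n$. A circuit of length $h$ is a function $\pi:\{0,1,\dots,h\}\to\{1,\dots,n\}$ with $\pi(0)=\pi(h)$. A word of length $h$ is a sequence of $h$ letters in which the first occurrences of the letters are in alphabetical order (equivalently, a partition of $\{1,\dots,h\}$); $w[i]$ is its $i$-th letter. A word is pair-matched if every letter in it appears exactly twice; $\mathcal{W}_{2k}^{(p)}$ is the set of pair-matched words of length $2k$ (each has $k$ distinct letters). For $w\in\mathcal{W}_{2k}^{(p)}$, $\Pi_\theta^*(w)$ is the set of circuits $\pi$ of length $2k$ (with values in $\{1,\dots,n\}$) such that $w[i]=w[j]$ implies $L_\theta(\pi(i-1),\pi(i))=L_\theta(\pi(j-1),\pi(j))$ for all $1\le i,j\le 2k$; $\#$ denotes cardinality. The set of generating indices is $S(w)=\{0\}\cup\{i\ge 1: w[i]\text{ is the first occurrence of its letter}\}$, so $\#S(w)=k+1$. Let $(i_s,j_s)$, $1\le s\le k$, with $i_s<j_s$ and $w[i_s]=w[j_s]$, be the $k$ matches of $w$. For $\gamma=(\gamma_1,\dots,\gamma_k)\in\mathcal{A}_\theta^k$ consider the equations $(\nu_{i_s-1}+\nu_{i_s})-(\nu_{j_s-1}+\nu_{j_s})=\gamma_s$, $1\le s\le k$. Solving them successively from left to right, i.e. $\nu_{j_s}=\nu_{i_s-1}+\nu_{i_s}-\nu_{j_s-1}-\gamma_s$,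 expresses every $\nu_i$ with $i\in\{0,\dots,2k\}\setminus S(w)$ uniquely as $\nu_i=L_i^H(\nu_{S(w)})+a_i^{(\gamma)}$, where $L_i^H$ is a linear function of the variables $\nu_{S(w)}$ not depending on $\gamma$, and $a_i^{(\gamma)}$ is an integer depending on $\gamma$ and $w$. (Note that $2k\notin S(w)$.) *)

theory Defs
  imports "HOL-Analysis.Analysis"
begin

text \<open>The alphabet is \<open>1, 2, 3, \<dots>\<close>, and the \<open>i\<close>-th letter \<open>w[i]\<close>, \<open>1 \<le> i \<le> length w\<close>,
  of a word \<open>w\<close> is \<open>w ! (i - 1)\<close>.\<close>

definition letter :: "nat list \<Rightarrow> nat \<Rightarrow> nat" where
  "letter w i = w ! (i - 1)"

text \<open>First occurrences in alphabetical order: each letter has already occurred or is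
  the first letter of the alphabet not used so far.\<close>

definition is_word :: "nat list \<Rightarrow> bool" where
  "is_word w \<longleftrightarrow> (\<forall>i < length w. w ! i \<in> set (take i w) \<or> w ! i = Suc (card (set (take i w))))"

definition pair_matched_words :: "nat \<Rightarrow> nat list set" where
  "pair_matched_words k = {w. is_word w \<and> length w = 2 * k \<and> (\<forall>a \<in> set w. count_list w a = 2)}"

definition link :: "real \<Rightarrow> nat \<Rightarrow> nat \<Rightarrow> nat \<Rightarrow> nat" where
  "link \<theta> n i j = (i + j) mod nat \<lfloor>real n / \<theta>\<rfloor>"

definition circuits :: "nat \<Rightarrow> nat \<Rightarrow> (nat \<Rightarrow> nat) set" where
  "circuits n h = {\<pi> \<in> {0..h} \<rightarrow>\<^sub>E {1..n}. \<pi> 0 = \<pi> h}"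

definition Pi_star :: "real \<Rightarrow> nat \<Rightarrow> nat list \<Rightarrow> (nat \<Rightarrow> nat) set" where
  "Pi_star \<theta> n w = {\<pi> \<in> circuits n (length w).
     \<forall>i \<in> {1..length w}. \<forall>j \<in> {1..length w}. letter w i = letter w j \<longrightarrow>
       link \<theta> n (\<pi> (i - 1)) (\<pi> i) = link \<theta> n (\<pi> (j - 1)) (\<pi> j)}"

definition scaled_count :: "real \<Rightarrow> nat \<Rightarrow> nat list \<Rightarrow> nat \<Rightarrow> real" where
  "scaled_count \<theta> k w n = real (card (Pi_star \<theta> n w)) / real n ^ (k + 1)"

definition p_theta :: "real \<Rightarrow> nat \<Rightarrow> nat list \<Rightarrow> real" where
  "p_theta \<theta> k w = lim (scaled_count \<theta> k w)"

definition gen_indices :: "nat list \<Rightarrow> nat set" where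
  "gen_indices w = {0} \<union> {i \<in> {1..length w}. \<forall>j \<in> {1..<i}. letter w j \<noteq> letter w i}"

definition dep_indices :: "nat list \<Rightarrow> nat set" where
  "dep_indices w = {0..length w} - gen_indices w"

definition matches :: "nat list \<Rightarrow> (nat \<times> nat) set" where
  "matches w = {(i, j). 1 \<le> i \<and> i < j \<and> j \<le> length w \<and> letter w i = letter w j}"

text \<open>For a pair-matched word and a dependent index \<open>j\<close>, this is the \<open>i\<close> with
  \<open>(i, j) \<in> matches w\<close>.\<close>

definition mate :: "nat list \<Rightarrow> nat \<Rightarrow> nat" where
  "mate w j = (LEAST i. 1 \<le> i \<and> letter w i = letter w j)"

lemma gen_indices_zero [simp]: "0 \<in> gen_indices w"
  by (simp add: gen_indices_def)

lemma dep_indices_pos: "j \<in> dep_indices w \<Longrightarrow> 0 < j"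
  by (cases j) (auto simp: dep_indices_def)

lemma mate_less:
  assumes "j \<in> dep_indices w"
  shows "mate w j < j"
proof -
  from assms obtain i where i: "1 \<le> i" "i < j" "letter w i = letter w j"
    using dep_indices_pos[OF assms] by (auto simp: dep_indices_def gen_indices_def)
  have "mate w j \<le> i"
    unfolding mate_def using i by (intro Least_le) auto
  with i show ?thesis by simp
qed

text \<open>The successive solution \<open>\<nu>\<^sub>j = \<nu>\<^sub>i\<^sub>-\<^sub>1 + \<nu>\<^sub>i - \<nu>\<^sub>j\<^sub>-\<^sub>1 - \<gamma>\<^sub>s\<close> (with \<open>i = mate w j\<close>) of the
  matching equations, split into its part \<open>lin_H\<close> linear in the generating variables and its
  integer part \<open>shift\<close>. Matches are numbered by their letter, so \<open>\<gamma>\<^sub>s\<close> is \<open>\<gamma> (letter w j)\<close>.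
  Lemma \<open>matching_equations_iff\<close> below confirms that this is the unique solution.\<close>

function lin_H :: "nat list \<Rightarrow> nat \<Rightarrow> (nat \<Rightarrow> real) \<Rightarrow> real" where
  "lin_H w j \<nu> =
     (if j \<in> dep_indices w
      then lin_H w (mate w j - 1) \<nu> + lin_H w (mate w j) \<nu> - lin_H w (j - 1) \<nu>
      else \<nu> j)"
  by auto
termination
  by (relation "Wellfounded.measure (\<lambda>(w, j, \<nu>). j)")
     (auto dest: mate_less dep_indices_pos intro: le_less_trans[OF diff_le_self])

function shift :: "nat list \<Rightarrow> nat \<Rightarrow> (nat \<Rightarrow> int) \<Rightarrow> int" where
  "shift w j \<gamma> =
     (if j \<in> dep_indices w
      then shift w (mate w j - 1) \<gamma> + shift w (mate w j) \<gamma> - shift w (j - 1) \<gamma> - \<gamma> (letter w j)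
      else 0)"
  by auto
termination
  by (relation "Wellfounded.measure (\<lambda>(w, j, \<gamma>). j)")
     (auto dest: mate_less dep_indices_pos intro: le_less_trans[OF diff_le_self])

declare lin_H.simps [simp del] shift.simps [simp del]

lemma lin_H_linear:
  "lin_H w j (\<lambda>i. a * \<mu> i + b * \<nu> i) = a * lin_H w j \<mu> + b * lin_H w j \<nu>"
proof (induction j rule: less_induct)
  case (less j)
  show ?case
  proof (cases "j \<in> dep_indices w")
    case True
    have "mate w j - 1 < j" "mate w j < j" "j - 1 < j"
      using mate_less[OF True] dep_indices_pos[OF True] by auto
    with less True show ?thesis
      by (subst (1 2 3) lin_H.simps) (simp add: algebra_simps)
  next
    case False
    then show ?thesis by (simp add: lin_H.simps)
  qed
qed

lemma lin_H_cong:
  assumes "\<And>i. i \<in> gen_indices w \<Longrightarrow> \<mu> i = \<nu> i" and "j \<le> length w"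
  shows "lin_H w j \<mu> = lin_H w j \<nu>"
  using assms(2)
proof (induction j rule: less_induct)
  case (less j)
  show ?case
  proof (cases "j \<in> dep_indices w")
    case True
    have lt: "mate w j - 1 < j" "mate w j < j" "j - 1 < j"
      using mate_less[OF True] dep_indices_pos[OF True] by auto
    with less.prems have "lin_H w (mate w j - 1) \<mu> = lin_H w (mate w j - 1) \<nu>"
      "lin_H w (mate w j) \<mu> = lin_H w (mate w j) \<nu>" "lin_H w (j - 1) \<mu> = lin_H w (j - 1) \<nu>"
      by (auto intro!: less.IH)
    then show ?thesis
      using True by (simp add: lin_H.simps[of w j])
  next
    case False
    with less.prems assms(1) show ?thesis
      by (simp add: lin_H.simps dep_indices_def)
  qed
qed

lemma matches_iff_mate:
  assumes "w \<in> pair_matched_words k"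
  shows "(i, j) \<in> matches w \<longleftrightarrow> j \<in> dep_indices w \<and> i = mate w j"
proof
  assume ij: "(i, j) \<in> matches w"
  then have *: "1 \<le> i" "i < j" "j \<le> length w" "letter w i = letter w j"
    by (auto simp: matches_def)
  have dep: "j \<in> dep_indices w"
    using * by (auto simp: dep_indices_def gen_indices_def)
  define m where "m = mate w j"
  have m: "1 \<le> m" "letter w m = letter w j"
    using LeastI[of "\<lambda>i. 1 \<le> i \<and> letter w i = letter w j" i] * by (auto simp: m_def mate_def)
  have mj: "m < j" using mate_less[OF dep] by (simp add: m_def)
  have "i = m"
  proof (rule ccontr)
    assume ne: "i \<noteq> m"
    let ?I = "{l. l < length w \<and> w ! l = letter w j}"
    have "count_list w (letter w j) = card ?I"
      by (simp add: count_list_eq_length_filter length_filter_conv_card eq_commute)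
    moreover have "letter w j \<in> set w"
      using * by (auto simp: letter_def)
    ultimately have "card ?I = 2"
      using assms by (auto simp: pair_matched_words_def)
    moreover have "{i - 1, m - 1, j - 1} \<subseteq> ?I"
      using * m mj by (auto simp: letter_def)
    then have "card {i - 1, m - 1, j - 1} \<le> card ?I"
      by (intro card_mono) auto
    moreover have "card {i - 1, m - 1, j - 1} = 3"
      using * m mj ne by (auto simp: card_insert_if)
    ultimately show False by simp
  qed
  with dep show "j \<in> dep_indices w \<and> i = mate w j" by (simp add: m_def)
next
  assume "j \<in> dep_indices w \<and> i = mate w j"
  then have dep: "j \<in> dep_indices w" and i: "i = mate w j" by auto
  have "1 \<le> mate w j \<and> letter w (mate w j) = letter w j"
    unfolding mate_def by (rule LeastI[of _ j]) (use dep_indices_pos[OF dep] in auto)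
  with i mate_less[OF dep] dep show "(i, j) \<in> matches w"
    by (auto simp: matches_def dep_indices_def)
qed

lemma matching_equations_iff:
  fixes \<nu> :: "nat \<Rightarrow> real" and \<gamma> :: "nat \<Rightarrow> int"
  assumes w: "w \<in> pair_matched_words k"
  shows "(\<forall>(i, j) \<in> matches w. (\<nu> (i - 1) + \<nu> i) - (\<nu> (j - 1) + \<nu> j) = of_int (\<gamma> (letter w j)))
     \<longleftrightarrow> (\<forall>j \<in> dep_indices w. \<nu> j = lin_H w j \<nu> + of_int (shift w j \<gamma>))"
    (is "?E \<longleftrightarrow> ?S")
proof
  assume E: ?E
  have "\<nu> j = lin_H w j \<nu> + of_int (shift w j \<gamma>)" for j
  proof (induction j rule: less_induct)
    case (less j)
    show ?case
    proof (cases "j \<in> dep_indices w")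
      case True
      have lt: "mate w j - 1 < j" "mate w j < j" "j - 1 < j"
        using mate_less[OF True] dep_indices_pos[OF True] by auto
      have "(mate w j, j) \<in> matches w"
        using matches_iff_mate[OF w] True by blast
      with E have "\<nu> j = \<nu> (mate w j - 1) + \<nu> (mate w j) - \<nu> (j - 1) - of_int (\<gamma> (letter w j))"
        by fastforce
      moreover note less[OF lt(1)] less[OF lt(2)] less[OF lt(3)]
      ultimately show ?thesis
        using True lin_H.simps[of w j \<nu>] shift.simps[of w j \<gamma>] by simp
    next
      case False
      then show ?thesis by (simp add: lin_H.simps shift.simps)
    qed
  qed
  then show ?S by blast
next
  assume S: ?S
  have *: "\<nu> j = lin_H w j \<nu> + of_int (shift w j \<gamma>)" for j
    using S by (cases "j \<in> dep_indices w") (auto simp: lin_H.simps shift.simps)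
  show ?E
  proof (clarify)
    fix i j assume "(i, j) \<in> matches w"
    then have True: "j \<in> dep_indices w" and i: "i = mate w j"
      using matches_iff_mate[OF w] by blast+
    show "(\<nu> (i - 1) + \<nu> i) - (\<nu> (j - 1) + \<nu> j) = of_int (\<gamma> (letter w j))"
      using *[of j] *[of "j - 1"] *[of "mate w j"] *[of "mate w j - 1"] True
        lin_H.simps[of w j \<nu>] shift.simps[of w j \<gamma>] unfolding i by simp
  qed
qed

definition A_theta :: "real \<Rightarrow> int set" where
  "A_theta \<theta> = {- \<lfloor>2 * \<theta>\<rfloor> .. \<lfloor>2 * \<theta>\<rfloor>}"

end

theory Submission
  imports Defs
begin

text \<open>Put \<open>m = \<lfloor>n / \<theta>\<rfloor>\<close>. Two link values agree iff the sums of the indices differ by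
  \<open>m \<gamma>\<close> for an integer \<open>\<gamma>\<close>, which for large \<open>n\<close> lies in \<open>A_theta \<theta>\<close> because \<open>n / m \<longlonglongrightarrow> \<theta>\<close>. So the
  circuits split according to \<open>\<gamma>\<close>, and each part is parametrised by its generating coordinates,
  i.e. by the lattice points of a rescaled polytope. The number of these points divided by
  \<open>m ^ (k + 1)\<close> is the measure of the union of the cells that they span, and it converges by
  dominated convergence: the indicator functions converge off the hyperplanes
  \<open>lin_H w j \<nu> + shift w j \<gamma> \<in> {0, \<theta>}\<close>. These are null sets, as the coefficients of \<open>lin_H w j\<close>
  add up to 1, so that \<open>lin_H w j\<close> is not constant. The closing equation is either an identity
  in \<open>\<nu>\<close> up to a constant, or it fails almost everywhere; in both cases its indicator function
  converges pointwise almost everywhere.\<close>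

section \<open>Counting lattice points by integration\<close>

text \<open>By Fubini in the coordinate \<open>l\<close>: once the other coordinates are fixed,
  \<open>c l \<noteq> 0\<close> leaves a single value of \<open>x l\<close> on the hyperplane, and
  single points are null for \<open>lborel\<close>.\<close>

lemma AE_PiM_affine_neq:
  fixes c :: "'i \<Rightarrow> real" and b :: real
  assumes fin: "finite S" and l: "l \<in> S" "c l \<noteq> 0"
  shows "AE x in PiM S (\<lambda>_. lborel). (\<Sum>i\<in>S. c i * x i) \<noteq> b"
proof -
  interpret product_sigma_finite "\<lambda>_::'i. lborel :: real measure" ..
  define T where "T = S - {l}"
  have S: "S = insert l T" and T: "finite T" "l \<notin> T"
    using fin l by (auto simp: T_def)
  let ?N = "{x \<in> space (PiM S (\<lambda>_. lborel)). (\<Sum>i\<in>S. c i * x i) = b}"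
  have [measurable]: "(\<lambda>x. \<Sum>i\<in>S. c i * x i) \<in> borel_measurable (PiM S (\<lambda>_. lborel))"
    by (intro borel_measurable_sum borel_measurable_times borel_measurable_const)
       (use measurable_component_singleton[of _ S "\<lambda>_. lborel"] in auto)
  have N: "?N \<in> sets (PiM S (\<lambda>_. lborel))" by measurable
  have "emeasure (PiM S (\<lambda>_. lborel)) ?N = (\<integral>\<^sup>+x. indicator ?N x \<partial>PiM (insert l T) (\<lambda>_. lborel))"
    using N by (simp add: S)
  also have "\<dots> = (\<integral>\<^sup>+x. (\<integral>\<^sup>+y. indicator ?N (x(l := y)) \<partial>lborel) \<partial>PiM T (\<lambda>_. lborel))"
    by (rule product_nn_integral_insert[OF T]) (use N in \<open>simp add: S\<close>)
  also have "\<dots> \<le> (\<integral>\<^sup>+x. (\<integral>\<^sup>+y. indicator {(b - (\<Sum>i\<in>T. c i * x i)) / c l} y \<partial>lborel) \<partial>PiM T (\<lambda>_. lborel))"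
  proof (intro nn_integral_mono)
    fix x :: "'i \<Rightarrow> real" and y :: real
    have "(\<Sum>i\<in>S. c i * (x(l := y)) i) = c l * y + (\<Sum>i\<in>T. c i * x i)"
      unfolding S using T by (subst sum.insert) (auto intro!: sum.cong)
    then show "indicator ?N (x(l := y)) \<le> (indicator {(b - (\<Sum>i\<in>T. c i * x i)) / c l} y :: ennreal)"
      using l(2) by (auto simp: indicator_def field_simps)
  qed
  also have "\<dots> = 0" by simp
  finally have "emeasure (PiM S (\<lambda>_. lborel)) ?N = 0" by simp
  then show ?thesis
    using N by (intro AE_I[of _ _ ?N]) auto
qed

text \<open>Each lattice point \<open>p\<close> is the image of exactly one cell of side \<open>1 / m\<close>, so that
  counting becomes integration and dominated convergence applies.\<close>

definition ceil_grid :: "'i set \<Rightarrow> nat \<Rightarrow> ('i \<Rightarrow> real) \<Rightarrow> 'i \<Rightarrow> nat" where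
  "ceil_grid S m x = (\<lambda>i\<in>S. nat \<lceil>real m * x i\<rceil>)"

text \<open>The assumption \<open>p > 0\<close> matters: \<open>nat\<close> sends every non-positive
  ceiling to 0, so the fibre over 0 is a half-line instead of a cell.\<close>

lemma nat_ceiling_eq_iff:
  assumes "m > 0" "p > 0"
  shows "nat \<lceil>real m * x\<rceil> = p \<longleftrightarrow> x \<in> {(real p - 1) / real m<..real p / real m}"
proof -
  have "nat \<lceil>real m * x\<rceil> = p \<longleftrightarrow> \<lceil>real m * x\<rceil> = int p"
    using assms by linarith
  also have "\<dots> \<longleftrightarrow> real p - 1 < real m * x \<and> real m * x \<le> real p"
    by (simp add: ceiling_eq_iff)
  finally show ?thesis
    using assms by (simp add: field_simps)
qed

text \<open>The preimage of \<open>F\<close> is a disjoint union of \<open>card F\<close> half-open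
  cubes of side \<open>1 / m\<close>. Coordinates in \<open>F\<close> start at 1, which makes every
  fibre such a cube.\<close>

lemma ceil_grid_vimage:
  fixes F :: "('i \<Rightarrow> nat) set"
  assumes fin: "finite S" and F: "F \<subseteq> S \<rightarrow>\<^sub>E {1..N}" and m: "m > 0"
  shows "{x \<in> space (PiM S (\<lambda>_. lborel)). ceil_grid S m x \<in> F} \<in> sets (PiM S (\<lambda>_. lborel))" (is ?A)
    and "measure (PiM S (\<lambda>_. lborel)) {x \<in> space (PiM S (\<lambda>_. lborel)). ceil_grid S m x \<in> F}
      = real (card F) / real m ^ card S" (is ?B)
proof -
  interpret product_sigma_finite "\<lambda>_::'i. lborel :: real measure" ..
  let ?M = "PiM S (\<lambda>_. lborel :: real measure)"
  \<comment> \<open>Defined as a fibre, so that distinct points have disjoint cells by construction;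
    the box shape is derived next.\<close>
  define C where "C p = (S \<rightarrow>\<^sub>E UNIV) \<inter> {x. ceil_grid S m x = p}" for p :: "'i \<Rightarrow> nat"
  have finF: "finite F"
    using F by (rule finite_subset) (auto intro: finite_PiE fin)
  have C: "C p = PiE S (\<lambda>i. {(real (p i) - 1) / real m<..real (p i) / real m})" if "p \<in> F" for p
  proof -
    have p: "p \<in> extensional S" "\<And>i. i \<in> S \<Longrightarrow> p i > 0"
      using that F by (auto simp: PiE_def Pi_def Suc_le_eq)
    have "ceil_grid S m x = p \<longleftrightarrow> (\<forall>i\<in>S. nat \<lceil>real m * x i\<rceil> = p i)" for x
      unfolding ceil_grid_def using p(1) by (auto simp: fun_eq_iff restrict_def extensional_def)
    then show ?thesis
      unfolding C_def using p(2) m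
      by (auto simp: nat_ceiling_eq_iff PiE_iff simp del: greaterThanAtMost_iff)
  qed
  have emC: "emeasure ?M (C p) = ennreal (1 / real m ^ card S)" if "p \<in> F" for p
  proof -
    have "emeasure ?M (C p) = (\<Prod>i\<in>S. emeasure lborel {(real (p i) - 1) / real m<..real (p i) / real m})"
      unfolding C[OF that] by (rule emeasure_PiM) (use fin in auto)
    also have "\<dots> = (\<Prod>i\<in>S. ennreal (1 / real m))"
    proof (rule prod.cong)
      fix i
      have "(real (p i) - 1) / real m \<le> real (p i) / real m" by (simp add: divide_right_mono)
      then show "emeasure lborel {(real (p i) - 1) / real m<..real (p i) / real m} = ennreal (1 / real m)"
        by (simp add: diff_divide_distrib)
    qed simp
    finally show ?thesis
      by (simp add: ennreal_power power_one_over)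
  qed
  have setsC: "C p \<in> sets ?M" if "p \<in> F" for p
    unfolding C[OF that] using fin by (intro sets_PiM_I_finite) auto
  have eq: "{x \<in> space ?M. ceil_grid S m x \<in> F} = (\<Union>p\<in>F. C p)"
    by (auto simp: space_PiM C_def)
  show ?A unfolding eq using setsC finF by auto
  have "measure ?M (\<Union>p\<in>F. C p) = (\<Sum>p\<in>F. measure ?M (C p))"
    by (rule measure_finite_Union) (use finF setsC emC in \<open>auto simp: disjoint_family_on_def C_def\<close>)
  also have "\<dots> = (\<Sum>p\<in>F. 1 / real m ^ card S)"
    using emC by (intro sum.cong) (auto simp: measure_def)
  finally show ?B unfolding eq by simp
qed

text \<open>Rounding up moves the coordinate by at most \<open>1 / m n\<close>. Negative coordinates
  are excluded because \<open>nat\<close> truncates them to 0.\<close>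

lemma ceil_grid_tendsto:
  assumes "filterlim m at_top F" "i \<in> S" "x i \<ge> 0"
  shows "((\<lambda>n. real (ceil_grid S (m n) x i) / real (m n)) \<longlongrightarrow> x i) F"
proof (rule tendsto_sandwich)
  have m: "filterlim (\<lambda>n. real (m n)) at_top F"
    by (rule filterlim_compose[OF filterlim_real_sequentially assms(1)])
  have ev: "\<forall>\<^sub>F n in F. real (m n) > 0"
    by (rule eventually_compose_filterlim[OF eventually_gt_at_top m])
  have *: "real (ceil_grid S (m n) x i) = of_int \<lceil>real (m n) * x i\<rceil>" for n
    using assms(2,3) by (auto simp: ceil_grid_def)
  show "\<forall>\<^sub>F n in F. x i \<le> real (ceil_grid S (m n) x i) / real (m n)"
    using ev by eventually_elim (simp add: * field_simps)
  show "\<forall>\<^sub>F n in F. real (ceil_grid S (m n) x i) / real (m n) \<le> x i + 1 / real (m n)"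
    using ev
  proof eventually_elim
    case (elim n)
    have "of_int \<lceil>real (m n) * x i\<rceil> \<le> real (m n) * x i + 1" by linarith
    with elim show ?case by (simp add: * field_simps)
  qed
  show "((\<lambda>n. x i + 1 / real (m n)) \<longlongrightarrow> x i) F"
    using tendsto_add[OF tendsto_const tendsto_divide_0[OF tendsto_const filterlim_at_top_imp_at_infinity[OF m]]]
    by fastforce
qed simp

text \<open>For large \<open>n\<close> the quotient is the integral of the indicator of the preimage
  of \<open>F n\<close> under \<open>ceil_grid\<close>. The bound on \<open>N n\<close> keeps these
  preimages inside one fixed cube with side [0, B], whose indicator is the integrable
  majorant.\<close>

lemma lattice_count_tendsto_integral:
  fixes F :: "nat \<Rightarrow> ('i \<Rightarrow> nat) set" and f :: "('i \<Rightarrow> real) \<Rightarrow> real"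
  assumes fin: "finite S" and m: "filterlim m at_top sequentially"
    and F: "\<And>n. F n \<subseteq> S \<rightarrow>\<^sub>E {1..N n}"
    and N: "\<forall>\<^sub>F n in sequentially. real (N n) \<le> B * real (m n)"
    and f: "f \<in> borel_measurable (PiM S (\<lambda>_. lborel))"
    and lim: "AE x in PiM S (\<lambda>_. lborel). (\<lambda>n. of_bool (ceil_grid S (m n) x \<in> F n)) \<longlonglongrightarrow> f x"
  shows "(\<lambda>n. real (card (F n)) / real (m n) ^ card S) \<longlonglongrightarrow> (\<integral>x. f x \<partial>PiM S (\<lambda>_. lborel))"
proof -
  interpret product_sigma_finite "\<lambda>_::'i. lborel :: real measure" ..
  let ?M = "PiM S (\<lambda>_. lborel :: real measure)"
  have "\<forall>\<^sub>F n in sequentially. m n > 0"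
    by (rule eventually_compose_filterlim[OF eventually_gt_at_top m])
  then have "\<forall>\<^sub>F n in sequentially. m n > 0 \<and> real (N n) \<le> B * real (m n)"
    using N by (rule eventually_conj)
  \<comment> \<open>The bounds hold only eventually. Shifting the sequences by \<open>n0\<close>
    makes the majorant valid at every index; \<open>LIMSEQ_offset\<close> undoes the shift at the
    end.\<close>
  then obtain n0 where n0: "\<And>n. n \<ge> n0 \<Longrightarrow> m n > 0 \<and> real (N n) \<le> B * real (m n)"
    by (auto simp: eventually_sequentially)
  define G where "G n = {x \<in> space ?M. ceil_grid S (m n) x \<in> F n}" for n
  have G: "G n \<in> sets ?M" "measure ?M (G n) = real (card (F n)) / real (m n) ^ card S" if "n \<ge> n0" for n
    unfolding G_def using ceil_grid_vimage[OF fin F] n0[OF that] by auto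
  define box where "box = S \<rightarrow>\<^sub>E {0..B}"
  have box: "box \<in> sets ?M" unfolding box_def using fin by (intro sets_PiM_I_finite) auto
  have box_fin: "emeasure ?M box < \<infinity>"
    unfolding box_def using fin
    by (subst emeasure_PiM) (auto simp: emeasure_lborel_Icc_eq ennreal_prod_eq_top power_eq_top_ennreal less_top[symmetric])
  have Gbox: "G n \<subseteq> box" if n: "n \<ge> n0" for n
  proof
    fix x assume x: "x \<in> G n"
    have "x i \<in> {0..B}" if i: "i \<in> S" for i
    proof -
      have "ceil_grid S (m n) x i \<in> {1..N n}"
        using x F[of n] i by (auto simp: G_def PiE_iff)
      \<comment> \<open>Lattice coordinates start at 1, which forces \<open>x i\<close> to be
        positive in spite of the truncation by \<open>nat\<close>.\<close>
      then have "1 \<le> nat \<lceil>real (m n) * x i\<rceil>" "nat \<lceil>real (m n) * x i\<rceil> \<le> N n"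
        using i by (simp_all add: ceil_grid_def)
      then have "0 < real (m n) * x i" "real (m n) * x i \<le> real (N n)"
        using real_nat_ceiling_ge[of "real (m n) * x i"] by linarith+
      moreover from this have "x i * real (m n) \<le> B * real (m n)"
        using n0[OF n] by (metis mult.commute order_trans)
      ultimately show ?thesis using n0[OF n] by (simp add: zero_less_mult_iff)
    qed
    then show "x \<in> box" using x by (auto simp: G_def box_def space_PiM PiE_iff)
  qed
  have "(\<lambda>n. \<integral>x. indicator (G (n + n0)) x \<partial>?M) \<longlonglongrightarrow> (\<integral>x. f x \<partial>?M)"
  proof (rule integral_dominated_convergence[where w = "indicator box"])
    show "integrable ?M (indicator box :: _ \<Rightarrow> real)"
      using box box_fin by (simp add: integrable_indicator_iff)
    show "AE x in ?M. (\<lambda>n. indicator (G (n + n0)) x :: real) \<longlonglongrightarrow> f x"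
      using lim AE_space
    proof eventually_elim
      case (elim x)
      have "(\<lambda>n. of_bool (ceil_grid S (m (n + n0)) x \<in> F (n + n0)) :: real) \<longlonglongrightarrow> f x"
        using LIMSEQ_ignore_initial_segment[OF elim(1)] .
      then show ?case using elim(2) by (simp add: G_def indicator_def of_bool_def)
    qed
    show "AE x in ?M. norm (indicator (G (n + n0)) x :: real) \<le> indicator box x" for n
      using Gbox[of "n + n0"] by (auto simp: indicator_def)
  qed (use f G in auto)
  also have "(\<lambda>n. \<integral>x. indicator (G (n + n0)) x \<partial>?M)
    = (\<lambda>n. real (card (F (n + n0))) / real (m (n + n0)) ^ card S)"
  proof
    fix n
    have "G (n + n0) \<inter> space ?M = G (n + n0)" by (auto simp: G_def)
    then show "(\<integral>x. indicator (G (n + n0)) x \<partial>?M)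
        = real (card (F (n + n0))) / real (m (n + n0)) ^ card S"
      using G(2)[of "n + n0"] by simp
  qed
  finally show ?thesis by (rule LIMSEQ_offset)
qed

section \<open>The linear forms and pair-matched words\<close>

text \<open>The coefficients of the form are its values at the unit vectors. As an explicit finite
  sum the form is visibly measurable and continuous, and its level sets are accessible to
  \<open>AE_PiM_affine_neq\<close>. The bound on \<open>j\<close> ensures that an index that is not
  dependent is generating.\<close>

lemma lin_H_eq_sum:
  assumes "j \<le> length w"
  shows "lin_H w j \<nu> = (\<Sum>i\<in>gen_indices w. lin_H w j (\<lambda>l. of_bool (l = i)) * \<nu> i)"
  using assms
proof (induction j rule: less_induct)
  case (less j)
  have fin: "finite (gen_indices w)" by (simp add: gen_indices_def)
  show ?case
  proof (cases "j \<in> dep_indices w")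
    case True
    have lt: "mate w j - 1 < j" "mate w j < j" "j - 1 < j"
      using mate_less[OF True] dep_indices_pos[OF True] by auto
    have "lin_H w j \<nu> = lin_H w (mate w j - 1) \<nu> + lin_H w (mate w j) \<nu> - lin_H w (j - 1) \<nu>"
      using True by (simp add: lin_H.simps[of w j])
    also have "\<dots> = (\<Sum>i\<in>gen_indices w. (lin_H w (mate w j - 1) (\<lambda>l. of_bool (l = i))
        + lin_H w (mate w j) (\<lambda>l. of_bool (l = i)) - lin_H w (j - 1) (\<lambda>l. of_bool (l = i))) * \<nu> i)"
      using lt less.prems
      by (subst (1 2 3) less.IH) (auto simp: sum.distrib sum_subtractf algebra_simps)
    also have "\<dots> = (\<Sum>i\<in>gen_indices w. lin_H w j (\<lambda>l. of_bool (l = i)) * \<nu> i)"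
      using True by (simp add: lin_H.simps[of w j])
    finally show ?thesis .
  next
    case False
    with less.prems have "j \<in> gen_indices w" by (auto simp: dep_indices_def)
    then show ?thesis
      using False fin by (simp add: lin_H.simps[of w j] of_bool_def if_distrib[of "\<lambda>x. x * _"] cong: if_cong)
  qed
qed

text \<open>Each step of the recursion computes 1 + 1 - 1. Together with \<open>lin_H_eq_sum\<close>
  this says that the coefficients add up to 1, so at least one is non-zero.\<close>

lemma lin_H_ones: "lin_H w j (\<lambda>_. 1) = 1"
proof (induction j rule: less_induct)
  case (less j)
  show ?case
  proof (cases "j \<in> dep_indices w")
    case True
    have "mate w j - 1 < j" "mate w j < j" "j - 1 < j"
      using mate_less[OF True] dep_indices_pos[OF True] by auto
    with less True show ?thesis by (simp add: lin_H.simps[of w j])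
  qed (simp add: lin_H.simps)
qed

text \<open>Integrality allows dependent coordinates that are computed over the reals to be read
  back as values of a circuit.\<close>

lemma lin_H_of_nat_in_Ints: "lin_H w j (\<lambda>i. real (p i)) \<in> \<int>"
proof (induction j rule: less_induct)
  case (less j)
  show ?case
  proof (cases "j \<in> dep_indices w")
    case True
    have "mate w j - 1 < j" "mate w j < j" "j - 1 < j"
      using mate_less[OF True] dep_indices_pos[OF True] by auto
    with less True show ?thesis by (auto simp: lin_H.simps[of w j])
  qed (simp add: lin_H.simps)
qed

lemma lin_H_divide: "lin_H w j (\<lambda>i. \<nu> i / c) = lin_H w j \<nu> / c"
  using lin_H_linear[of w j "1 / c" \<nu> 0 \<nu>] by simp

text \<open>Homogeneity in \<open>\<gamma>\<close> accounts for the factor \<open>m\<close> in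
  \<open>solution\<close>, where the right-hand sides are \<open>m \<gamma>\<close>.\<close>

lemma shift_mult: "shift w j (\<lambda>a. c * \<gamma> a) = c * shift w j \<gamma>"
proof (induction j rule: less_induct)
  case (less j)
  show ?case
  proof (cases "j \<in> dep_indices w")
    case True
    have "mate w j - 1 < j" "mate w j < j" "j - 1 < j"
      using mate_less[OF True] dep_indices_pos[OF True] by auto
    with less True show ?thesis
      by (simp add: shift.simps[of w j \<gamma>] shift.simps[of w j "\<lambda>a. c * \<gamma> a"] algebra_simps)
  qed (simp add: shift.simps)
qed

lemma finite_gen_indices [simp]: "finite (gen_indices w)"
  by (simp add: gen_indices_def)

lemma gen_indices_subset: "gen_indices w \<subseteq> {0..length w}"
  by (auto simp: gen_indices_def)

lemma measurable_lin_H: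
  assumes "j \<le> length w"
  shows "lin_H w j \<in> borel_measurable (PiM (gen_indices w) (\<lambda>_. lborel))"
proof -
  have "lin_H w j = (\<lambda>\<nu>. \<Sum>i\<in>gen_indices w. lin_H w j (\<lambda>l. of_bool (l = i)) * \<nu> i)"
    using lin_H_eq_sum[OF assms] by (rule ext)
  moreover have "\<dots> \<in> borel_measurable (PiM (gen_indices w) (\<lambda>_. lborel))"
    by (intro borel_measurable_sum borel_measurable_times borel_measurable_const)
       (use measurable_component_singleton[of _ "gen_indices w" "\<lambda>_. lborel"] in auto)
  ultimately show ?thesis by simp
qed

lemma AE_lin_H_neq:
  assumes j: "j \<le> length w"
  shows "AE \<nu> in PiM (gen_indices w) (\<lambda>_. lborel). lin_H w j \<nu> \<noteq> b"
proof -
  have "(\<Sum>i\<in>gen_indices w. lin_H w j (\<lambda>l. of_bool (l = i))) = 1"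
    using lin_H_eq_sum[OF j, of "\<lambda>_. 1"] lin_H_ones by simp
  then obtain i where "i \<in> gen_indices w" "lin_H w j (\<lambda>l. of_bool (l = i)) \<noteq> 0"
    by (metis (no_types, lifting) sum.neutral zero_neq_one)
  from AE_PiM_affine_neq[of "gen_indices w" i "\<lambda>i. lin_H w j (\<lambda>l. of_bool (l = i))" b,
      OF finite_gen_indices this] show ?thesis
    by eventually_elim (subst lin_H_eq_sum[OF j], assumption)
qed

text \<open>Either all coefficients of \<open>\<nu> 0 - lin_H w j \<nu>\<close> vanish, and the
  closing equation is a condition on the constant \<open>b\<close> alone, or its solutions form a
  hyperplane, which is null for every \<open>b\<close>.\<close>

lemma AE_closing_equation_cases:
  assumes j: "j \<le> length w"
  shows "(\<forall>\<nu>. lin_H w j \<nu> = \<nu> 0) \<or>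
    (AE \<nu> in PiM (gen_indices w) (\<lambda>_. lborel). \<nu> 0 \<noteq> lin_H w j \<nu> + b)"
proof -
  define c where "c i = of_bool (i = 0) - lin_H w j (\<lambda>l. of_bool (l = i))" for i
  have "(\<Sum>i\<in>gen_indices w. of_bool (i = 0) * \<nu> i) = \<nu> 0" for \<nu> :: "nat \<Rightarrow> real"
    by (simp add: of_bool_def if_distrib[of "\<lambda>x. x * _"] cong: if_cong)
  then have *: "(\<Sum>i\<in>gen_indices w. c i * \<nu> i) = \<nu> 0 - lin_H w j \<nu>" for \<nu>
    by (simp add: c_def left_diff_distrib sum_subtractf lin_H_eq_sum[OF j, symmetric])
  show ?thesis
  proof (cases "\<exists>i\<in>gen_indices w. c i \<noteq> 0")
    case True
    then obtain i where "i \<in> gen_indices w" "c i \<noteq> 0" by blast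
    from AE_PiM_affine_neq[of "gen_indices w" i c b, OF finite_gen_indices this]
    have "AE \<nu> in PiM (gen_indices w) (\<lambda>_. lborel). \<nu> 0 \<noteq> lin_H w j \<nu> + b"
      unfolding * by eventually_elim linarith
    then show ?thesis ..
  next
    case False
    then have "\<nu> 0 - lin_H w j \<nu> = 0" for \<nu>
      by (simp add: *[symmetric])
    then show ?thesis by simp
  qed
qed

section \<open>Combinatorics of pair-matched words\<close>

lemma set_take_word:
  assumes "is_word w" "i \<le> length w"
  shows "set (take i w) = {1..card (set (take i w))}"
  using assms(2)
proof (induction i)
  case (Suc i)
  let ?S = "set (take i w)"
  have IH: "?S = {1..card ?S}" using Suc by simp
  have eq: "set (take (Suc i) w) = insert (w ! i) ?S"
    using Suc.prems by (simp add: take_Suc_conv_app_nth)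
  have "w ! i \<in> ?S \<or> w ! i = Suc (card ?S)"
    using assms(1) Suc.prems by (auto simp: is_word_def)
  then show ?case
  proof
    assume "w ! i \<in> ?S"
    then show ?thesis using IH by (simp only: eq insert_absorb)
  next
    assume *: "w ! i = Suc (card ?S)"
    \<comment> \<open>By \<open>IH\<close> the letters used so far form an initial segment of the
      alphabet, so its successor is new and extends the segment.\<close>
    then have "w ! i \<notin> ?S" using IH by (metis Suc_n_not_le_n atLeastAtMost_iff)
    then have "card (insert (w ! i) ?S) = Suc (card ?S)" by simp
    moreover have "insert (w ! i) ?S = {1..Suc (card ?S)}"
      by (subst IH) (auto simp: *)
    ultimately show ?thesis by (simp only: eq)
  qed
qed simp

context
  fixes w :: "nat list" and k :: nat
  assumes w: "w \<in> pair_matched_words k"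
begin

lemma length_pair_matched: "length w = 2 * k"
  using w by (simp add: pair_matched_words_def)

text \<open>Counting each letter twice gives \<open>k\<close> letters, and alphabetical first
  occurrences make them an initial segment. This is why tuples \<open>\<gamma>\<close> can be
  indexed by {1..k}.\<close>

lemma set_pair_matched: "set w = {1..k}"
proof -
  have "(\<Sum>a\<in>set w. count_list w a) = length w" by (rule sum_count_set) auto
  moreover have "(\<Sum>a\<in>set w. count_list w a) = (\<Sum>a\<in>set w. 2)"
    using w by (intro sum.cong) (auto simp: pair_matched_words_def)
  ultimately have "card (set w) = k" by (simp add: length_pair_matched)
  moreover have "is_word w" using w by (simp add: pair_matched_words_def)
  ultimately show ?thesis using set_take_word[of w "length w"] by simp
qed

lemma letter_in: "i \<in> {1..2 * k} \<Longrightarrow> letter w i \<in> {1..k}"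
  unfolding set_pair_matched[symmetric] letter_def
  using length_pair_matched by (intro nth_mem) auto

text \<open>First occurrences correspond bijectively to letters, and the index 0 comes on top. This
  is the dimension of the integral and the exponent of the normalisation.\<close>

lemma card_gen_indices: "card (gen_indices w) = k + 1"
proof -
  define P where "P = gen_indices w - {0}"
  have P: "P = {i \<in> {1..length w}. \<forall>j \<in> {1..<i}. letter w j \<noteq> letter w i}"
    by (auto simp: P_def gen_indices_def)
  have "bij_betw (letter w) P (set w)"
  proof (rule bij_betw_imageI)
    show "inj_on (letter w) P"
    proof (rule linorder_inj_onI)
      fix i j assume "i < j" "i \<in> P" "j \<in> P"
      then show "letter w i \<noteq> letter w j" by (auto simp: P)
    qed auto
    show "letter w ` P = set w"
    proof (intro equalityI subsetI)
      fix a assume "a \<in> set w"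
      then obtain l where l: "l < length w" "w ! l = a" by (auto simp: in_set_conv_nth)
      define i where "i = (LEAST i. 1 \<le> i \<and> letter w i = a)"
      have "1 \<le> Suc l \<and> letter w (Suc l) = a" using l by (simp add: letter_def)
      from LeastI[of "\<lambda>i. 1 \<le> i \<and> letter w i = a", OF this]
        Least_le[of "\<lambda>i. 1 \<le> i \<and> letter w i = a", OF this]
      have "1 \<le> i" "letter w i = a" "i \<le> Suc l" by (auto simp: i_def)
      moreover have "letter w j \<noteq> a" if "1 \<le> j" "j < i" for j
        using not_less_Least[of j "\<lambda>i. 1 \<le> i \<and> letter w i = a"] that by (auto simp: i_def)
      ultimately show "a \<in> letter w ` P" using l by (auto simp: P)
    qed (use letter_in in \<open>auto simp: P length_pair_matched set_pair_matched\<close>)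
  qed
  then have "card P = k"
    by (simp add: bij_betw_same_card set_pair_matched)
  moreover have "card (gen_indices w) = Suc (card P)"
    unfolding P_def by (rule card.remove) simp_all
  ultimately show ?thesis by simp
qed

text \<open>Dependent indices are the second occurrences, so their letters are distinct; since there
  are (2k + 1) - (k + 1) = k of them, every letter is reached.\<close>

lemma bij_betw_letter_dep: "bij_betw (letter w) (dep_indices w) {1..k}"
proof -
  have sub: "dep_indices w \<subseteq> {1..2 * k}"
    using length_pair_matched dep_indices_pos by (fastforce simp: dep_indices_def)
  have "card (dep_indices w) = card {0..length w} - card (gen_indices w)"
    unfolding dep_indices_def by (intro card_Diff_subset gen_indices_subset) simp
  then have "card (dep_indices w) = card {1..k}"
    by (simp add: card_gen_indices length_pair_matched)
  moreover have inj: "inj_on (letter w) (dep_indices w)"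
  proof (rule linorder_inj_onI)
    fix i j assume ij: "i < j" "i \<in> dep_indices w" "j \<in> dep_indices w"
    show "letter w i \<noteq> letter w j"
    proof
      assume eq: "letter w i = letter w j"
      \<comment> \<open>\<open>mate\<close> depends on the letter only, so \<open>i\<close> would be
        its own mate, although mates are strictly smaller.\<close>
      have "(i, j) \<in> matches w" using ij eq sub by (auto simp: matches_def length_pair_matched)
      then have "i = mate w j" using matches_iff_mate[OF w] by blast
      moreover have "mate w j = mate w i" using eq by (simp add: mate_def)
      ultimately show False using mate_less[OF ij(2)] by simp
    qed
  qed auto
  moreover have "letter w ` dep_indices w \<subseteq> {1..k}" using sub letter_in by blast
  ultimately have "letter w ` dep_indices w = {1..k}"
    by (intro card_subset_eq) (auto simp: card_image)
  with inj show ?thesis by (rule bij_betw_imageI)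
qed

text \<open>The final letter is carried by some dependent index; were this an earlier one, it would
  form a match with 2k and make 2k dependent too. The closing condition can therefore be expressed
  through the form at 2k.\<close>

lemma last_in_dep_indices:
  assumes "k \<ge> 1"
  shows "2 * k \<in> dep_indices w"
proof (rule ccontr)
  assume n: "2 * k \<notin> dep_indices w"
  have "letter w (2 * k) \<in> letter w ` dep_indices w"
    using letter_in assms bij_betw_letter_dep by (simp add: bij_betw_def)
  then obtain j where j: "j \<in> dep_indices w" "letter w j = letter w (2 * k)" by auto
  with n have "1 \<le> j" "j < 2 * k"
    using dep_indices_pos[OF j(1)] length_pair_matched
    by (auto simp: dep_indices_def le_less)
  with j have "(j, 2 * k) \<in> matches w" by (auto simp: matches_def length_pair_matched)
  with n show False using matches_iff_mate[OF w] by blast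
qed

end

section \<open>Circuits and their generating coordinates\<close>

text \<open>The piece of \<open>Pi_star\<close> belonging to one \<open>\<gamma>\<close>, with
  \<open>m\<close> in the role of the modulus. The equations live in the integers because the
  differences may be negative.\<close>

definition matched_circuits :: "nat list \<Rightarrow> nat \<Rightarrow> nat \<Rightarrow> (nat \<Rightarrow> int) \<Rightarrow> (nat \<Rightarrow> nat) set" where
  "matched_circuits w n m \<gamma> = {\<pi> \<in> circuits n (length w). \<forall>(i, j) \<in> matches w.
     (int (\<pi> (i - 1)) + int (\<pi> i)) - (int (\<pi> (j - 1)) + int (\<pi> j)) = int m * \<gamma> (letter w j)}"

text \<open>All coordinates are kept integral, i.e. \<open>\<nu>\<^sub>j = \<pi>(j) / m\<close> in the notation of the
  theorem, which turns the right-hand sides \<open>\<gamma>\<close> into \<open>m \<gamma>\<close>.\<close>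

definition solution :: "nat list \<Rightarrow> nat \<Rightarrow> (nat \<Rightarrow> int) \<Rightarrow> nat \<Rightarrow> (nat \<Rightarrow> nat) \<Rightarrow> real" where
  "solution w m \<gamma> j p = lin_H w j (\<lambda>i. real (p i)) + real m * of_int (shift w j \<gamma>)"

text \<open>The restrictions of matched circuits to the generating indices; the last condition is
  \<pi>(0) = \<pi>(2k) after elimination of the dependent coordinates.\<close>

definition generators :: "nat list \<Rightarrow> nat \<Rightarrow> nat \<Rightarrow> (nat \<Rightarrow> int) \<Rightarrow> (nat \<Rightarrow> nat) set" where
  "generators w n m \<gamma> = {p \<in> gen_indices w \<rightarrow>\<^sub>E {1..n}.
     (\<forall>j \<in> dep_indices w. solution w m \<gamma> j p \<in> {1..real n}) \<and>
     real (p 0) = solution w m \<gamma> (length w) p}"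

lemma solution_gen: "j \<notin> dep_indices w \<Longrightarrow> solution w m \<gamma> j p = real (p j)"
  by (simp add: solution_def lin_H.simps shift.simps)

lemma solution_cong:
  "(\<And>i. i \<in> gen_indices w \<Longrightarrow> p i = q i) \<Longrightarrow> j \<le> length w \<Longrightarrow> solution w m \<gamma> j p = solution w m \<gamma> j q"
  unfolding solution_def by (subst lin_H_cong[of w _ "\<lambda>i. real (q i)"]) auto

lemma solution_in_Ints: "solution w m \<gamma> j p \<in> \<int>"
  unfolding solution_def using lin_H_of_nat_in_Ints by (auto intro!: Ints_add Ints_mult)

text \<open>This is \<open>matching_equations_iff\<close> with right-hand sides
  \<open>m \<gamma>\<close>, after embedding the integer equations into the reals.\<close>

lemma matched_circuits_iff:
  assumes "w \<in> pair_matched_words k"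
  shows "\<pi> \<in> matched_circuits w n m \<gamma> \<longleftrightarrow>
    \<pi> \<in> circuits n (length w) \<and> (\<forall>j \<in> dep_indices w. real (\<pi> j) = solution w m \<gamma> j \<pi>)"
proof -
  have "(\<forall>(i, j) \<in> matches w. (int (\<pi> (i - 1)) + int (\<pi> i)) - (int (\<pi> (j - 1)) + int (\<pi> j)) = int m * \<gamma> (letter w j))
    \<longleftrightarrow> (\<forall>(i, j) \<in> matches w. (real (\<pi> (i - 1)) + real (\<pi> i)) - (real (\<pi> (j - 1)) + real (\<pi> j))
        = of_int (int m * \<gamma> (letter w j)))"
    unfolding of_int_eq_iff[where ?'a = real, symmetric] by simp
  also have "\<dots> \<longleftrightarrow> (\<forall>j \<in> dep_indices w. real (\<pi> j) = solution w m \<gamma> j \<pi>)"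
    using matching_equations_iff[OF assms, of "\<lambda>i. real (\<pi> i)" "\<lambda>a. int m * \<gamma> a"]
    by (simp add: solution_def shift_mult)
  finally show ?thesis by (simp add: matched_circuits_def)
qed

text \<open>Injectivity: the generating coordinates determine all others through
  \<open>solution\<close>. Surjectivity: the solved coordinates are integers between 1 and
  \<open>n\<close>, hence complete a point to a circuit.\<close>

lemma bij_betw_generators:
  assumes w: "w \<in> pair_matched_words k" and k: "k \<ge> 1"
  shows "bij_betw (\<lambda>\<pi>. restrict \<pi> (gen_indices w)) (matched_circuits w n m \<gamma>) (generators w n m \<gamma>)"
proof (rule bij_betw_imageI)
  have last: "length w \<in> dep_indices w"
    using last_in_dep_indices[OF w k] by (simp add: length_pair_matched[OF w])
  show "inj_on (\<lambda>\<pi>. restrict \<pi> (gen_indices w)) (matched_circuits w n m \<gamma>)"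
  proof (rule inj_onI)
    fix \<pi> \<rho>
    assume *: "\<pi> \<in> matched_circuits w n m \<gamma>" "\<rho> \<in> matched_circuits w n m \<gamma>"
      "restrict \<pi> (gen_indices w) = restrict \<rho> (gen_indices w)"
    have gen: "\<pi> i = \<rho> i" if "i \<in> gen_indices w" for i
      using fun_cong[OF *(3), of i] that by simp
    have dep: "\<pi> j = \<rho> j" if "j \<in> dep_indices w" for j
    proof -
      have "solution w m \<gamma> j \<pi> = solution w m \<gamma> j \<rho>"
        using gen that by (intro solution_cong) (auto simp: dep_indices_def)
      moreover have "real (\<pi> j) = solution w m \<gamma> j \<pi>" "real (\<rho> j) = solution w m \<gamma> j \<rho>"
        using *(1,2) that matched_circuits_iff[OF w] by blast+
      ultimately show ?thesis by simp
    qed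
    show "\<pi> = \<rho>"
    proof (rule extensionalityI[of _ "{0..length w}"])
      show "\<pi> j = \<rho> j" if "j \<in> {0..length w}" for j
        using gen dep that by (cases "j \<in> gen_indices w") (auto simp: dep_indices_def)
    qed (use * in \<open>auto simp: matched_circuits_def circuits_def PiE_iff\<close>)
  qed
  show "(\<lambda>\<pi>. restrict \<pi> (gen_indices w)) ` matched_circuits w n m \<gamma> = generators w n m \<gamma>"
  proof (intro equalityI subsetI)
    fix p assume "p \<in> (\<lambda>\<pi>. restrict \<pi> (gen_indices w)) ` matched_circuits w n m \<gamma>"
    then obtain \<pi> where \<pi>: "\<pi> \<in> matched_circuits w n m \<gamma>" and p: "p = restrict \<pi> (gen_indices w)"
      by auto
    have circ: "\<pi> j \<in> {1..n}" if "j \<le> length w" for j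
      using \<pi> that by (auto simp: matched_circuits_def circuits_def PiE_iff)
    have sol: "solution w m \<gamma> j p = real (\<pi> j)" if "j \<in> dep_indices w" for j
    proof -
      have "solution w m \<gamma> j p = solution w m \<gamma> j \<pi>"
        using that by (intro solution_cong) (auto simp: p dep_indices_def)
      then show ?thesis using \<pi> that by (simp add: matched_circuits_iff[OF w])
    qed
    have "\<pi> 0 = \<pi> (length w)" using \<pi> by (simp add: matched_circuits_def circuits_def)
    moreover have "p \<in> gen_indices w \<rightarrow>\<^sub>E {1..n}"
      unfolding p using circ gen_indices_subset[of w] by force
    ultimately show "p \<in> generators w n m \<gamma>"
      using sol circ last by (auto simp: generators_def p dep_indices_def Suc_le_eq)
  next
    fix p assume p: "p \<in> generators w n m \<gamma>"
    \<comment> \<open>The floor recovers the integer value exactly. Beyond \<open>length w\<close>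
      the function \<open>p\<close> is already \<open>undefined\<close>, so the extension is
      extensional on {0..length w}.\<close>
    define \<pi> where "\<pi> j = (if j \<in> dep_indices w then nat \<lfloor>solution w m \<gamma> j p\<rfloor> else p j)" for j
    have pgen: "p \<in> gen_indices w \<rightarrow>\<^sub>E {1..n}" and psol: "\<And>j. j \<in> dep_indices w \<Longrightarrow> solution w m \<gamma> j p \<in> {1..real n}"
      and p0: "real (p 0) = solution w m \<gamma> (length w) p"
      using p by (auto simp: generators_def)
    have gen: "\<pi> j = p j" if "j \<in> gen_indices w" for j
      using that by (simp add: \<pi>_def dep_indices_def)
    have dep: "real (\<pi> j) = solution w m \<gamma> j p" if "j \<in> dep_indices w" for j
    proof -
      obtain z where "solution w m \<gamma> j p = of_int z"
        using solution_in_Ints[of w m \<gamma> j p] by (auto elim: Ints_cases)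
      with psol[OF that] that show ?thesis by (simp add: \<pi>_def)
    qed
    have "\<pi> j \<in> {1..n}" if "j \<in> {0..length w}" for j
    proof (cases "j \<in> dep_indices w")
      case True
      then have "real (\<pi> j) \<in> {1..real n}" using dep psol by simp
      then show ?thesis by simp
    next
      case False
      with that have "j \<in> gen_indices w" by (simp add: dep_indices_def)
      with pgen show ?thesis by (simp add: gen PiE_iff)
    qed
    moreover have "\<pi> j = undefined" if "j \<notin> {0..length w}" for j
      using that pgen gen_indices_subset[of w] by (auto simp: \<pi>_def dep_indices_def PiE_iff extensional_def)
    moreover have "\<pi> 0 = \<pi> (length w)"
      using dep[OF last] p0 gen[of 0] by simp
    ultimately have "\<pi> \<in> circuits n (length w)"
      by (auto simp: circuits_def PiE_iff extensional_def)
    moreover have "real (\<pi> j) = solution w m \<gamma> j \<pi>" if "j \<in> dep_indices w" for j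
      using solution_cong[of w \<pi> p j] gen dep that by (simp add: dep_indices_def)
    ultimately have "\<pi> \<in> matched_circuits w n m \<gamma>"
      by (simp add: matched_circuits_iff[OF w])
    moreover have "p = restrict \<pi> (gen_indices w)"
      using gen pgen by (auto simp: fun_eq_iff restrict_def PiE_iff extensional_def)
    ultimately show "p \<in> (\<lambda>\<pi>. restrict \<pi> (gen_indices w)) ` matched_circuits w n m \<gamma>" by blast
  qed
qed

text \<open>Equal link values mean that the sums differ by a multiple of \<open>m\<close>. The
  assumption \<open>bound\<close> limits the multiplier to \<open>A_theta \<theta>\<close>, since
  two such sums differ by less than \<open>2 * n\<close>.\<close>

lemma Pi_star_eq_UN:
  assumes w: "w \<in> pair_matched_words k"
    and m: "m = nat \<lfloor>real n / \<theta>\<rfloor>" "m > 0"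
    and bound: "2 * real n < real m * (of_int \<lfloor>2 * \<theta>\<rfloor> + 1)"
  shows "Pi_star \<theta> n w = (\<Union>\<gamma> \<in> {1..k} \<rightarrow>\<^sub>E A_theta \<theta>. matched_circuits w n m \<gamma>)"
proof (intro equalityI subsetI)
  define d where "d \<pi> i j = (int (\<pi> (i - 1)) + int (\<pi> i)) - (int (\<pi> (j - 1)) + int (\<pi> j))"
    for \<pi> :: "nat \<Rightarrow> nat" and i j
  have link_iff: "link \<theta> n (\<pi> (i - 1)) (\<pi> i) = link \<theta> n (\<pi> (j - 1)) (\<pi> j) \<longleftrightarrow> int m dvd d \<pi> i j" for \<pi> i j
  proof -
    have "link \<theta> n (\<pi> (i - 1)) (\<pi> i) = link \<theta> n (\<pi> (j - 1)) (\<pi> j) \<longleftrightarrow>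
        (int (\<pi> (i - 1)) + int (\<pi> i)) mod int m = (int (\<pi> (j - 1)) + int (\<pi> j)) mod int m"
      unfolding link_def m(1)[symmetric] by (metis of_nat_add of_nat_eq_iff of_nat_mod)
    then show ?thesis by (simp add: d_def mod_eq_dvd_iff)
  qed
  note bij = bij_betw_letter_dep[OF w]
  fix \<pi>
  {
    assume \<pi>: "\<pi> \<in> Pi_star \<theta> n w"
    define e where "e j = d \<pi> (mate w j) j" for j
    define g where "g j = e j div int m" for j
    \<comment> \<open>Tuples are indexed by letters, so the quotients \<open>g\<close> are carried
      over from dependent indices along the inverse of the bijection.\<close>
    define \<gamma> where "\<gamma> = (\<lambda>a\<in>{1..k}. g (inv_into (dep_indices w) (letter w) a))"
    have e: "e j = int m * g j" "g j \<in> A_theta \<theta>" if j: "j \<in> dep_indices w" for j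
    proof -
      have "(mate w j, j) \<in> matches w" using matches_iff_mate[OF w] j by blast
      then have mj: "1 \<le> mate w j" "mate w j < j" "j \<le> length w" "letter w (mate w j) = letter w j"
        by (auto simp: matches_def)
      then have "int m dvd e j"
        using \<pi> by (auto simp: Pi_star_def e_def link_iff[symmetric])
      then show eg: "e j = int m * g j" by (simp add: g_def)
      have "\<pi> i \<in> {1..n}" if "i \<le> length w" for i
        using \<pi> that by (auto simp: Pi_star_def circuits_def PiE_iff)
      moreover have "mate w j - 1 \<le> length w" "mate w j \<le> length w" "j - 1 \<le> length w"
        using mj by simp_all
      ultimately have "\<pi> (mate w j - 1) \<in> {1..n}" "\<pi> (mate w j) \<in> {1..n}" "\<pi> (j - 1) \<in> {1..n}" "\<pi> j \<in> {1..n}"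
        using mj(3) by blast+
      \<comment> \<open>Both sums lie between 2 and 2n, so the inequality is strict. The comparison
        with \<open>bound\<close> then passes through the reals and back.\<close>
      then have "\<bar>e j\<bar> < 2 * int n" by (auto simp: e_def d_def)
      then have "int m * \<bar>g j\<bar> < 2 * int n" by (simp add: eg abs_mult)
      then have "real_of_int (int m * \<bar>g j\<bar>) < real_of_int (2 * int n)" by (simp only: of_int_less_iff)
      with bound have "real_of_int (int m * \<bar>g j\<bar>) < real_of_int (int m * (\<lfloor>2 * \<theta>\<rfloor> + 1))"
        by simp
      then have "int m * \<bar>g j\<bar> < int m * (\<lfloor>2 * \<theta>\<rfloor> + 1)" by (simp only: of_int_less_iff)
      then have "\<bar>g j\<bar> < \<lfloor>2 * \<theta>\<rfloor> + 1" by (simp add: mult_less_cancel_left)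
      then show "g j \<in> A_theta \<theta>" by (auto simp: A_theta_def)
    qed
    have \<gamma>: "\<gamma> (letter w j) = g j" if "j \<in> dep_indices w" for j
      using bij that by (auto simp: \<gamma>_def bij_betw_def)
    have "\<gamma> \<in> {1..k} \<rightarrow>\<^sub>E A_theta \<theta>"
    proof (rule PiE_I)
      fix a assume "a \<in> {1..k}"
      then obtain j where "j \<in> dep_indices w" "a = letter w j"
        using bij_betw_imp_surj_on[OF bij] by blast
      then show "\<gamma> a \<in> A_theta \<theta>" using \<gamma> e by simp
    qed (auto simp: \<gamma>_def)
    moreover have "\<pi> \<in> matched_circuits w n m \<gamma>"
    proof -
      have "d \<pi> i j = int m * \<gamma> (letter w j)" if "(i, j) \<in> matches w" for i j
      proof -
        have "j \<in> dep_indices w" "i = mate w j" using that matches_iff_mate[OF w] by blast+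
        then show ?thesis using e \<gamma> by (simp add: e_def)
      qed
      then show ?thesis
        using \<pi> by (auto simp: matched_circuits_def Pi_star_def d_def)
    qed
    ultimately show "\<pi> \<in> (\<Union>\<gamma> \<in> {1..k} \<rightarrow>\<^sub>E A_theta \<theta>. matched_circuits w n m \<gamma>)" by blast
  next
    assume "\<pi> \<in> (\<Union>\<gamma> \<in> {1..k} \<rightarrow>\<^sub>E A_theta \<theta>. matched_circuits w n m \<gamma>)"
    then obtain \<gamma> where \<pi>: "\<pi> \<in> matched_circuits w n m \<gamma>" by blast
    have "link \<theta> n (\<pi> (i - 1)) (\<pi> i) = link \<theta> n (\<pi> (j - 1)) (\<pi> j)" if "(i, j) \<in> matches w" for i j
    proof -
      have "d \<pi> i j = int m * \<gamma> (letter w j)"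
        using \<pi> that by (auto simp: matched_circuits_def d_def)
      then show ?thesis unfolding link_iff by simp
    qed
    note * = this
    have "link \<theta> n (\<pi> (i - 1)) (\<pi> i) = link \<theta> n (\<pi> (j - 1)) (\<pi> j)"
      if "i \<in> {1..length w}" "j \<in> {1..length w}" "letter w i = letter w j" for i j
      using that *[of i j] *[of j i] by (cases i j rule: linorder_cases) (auto simp: matches_def)
    moreover have "\<pi> \<in> circuits n (length w)"
      using \<pi> by (simp add: matched_circuits_def)
    ultimately show "\<pi> \<in> Pi_star \<theta> n w"
      unfolding Pi_star_def by blast
  }
qed

lemma finite_A_theta [simp]: "finite (A_theta \<theta>)"
  by (simp add: A_theta_def)

lemma finite_circuits: "finite (circuits n h)"
  by (rule finite_subset[of _ "{0..h} \<rightarrow>\<^sub>E {1..n}"]) (auto simp: circuits_def intro: finite_PiE)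

text \<open>The pieces are disjoint: as \<open>m > 0\<close> and every letter belongs to a dependent
  index, the circuit determines \<open>\<gamma>\<close>. Each piece is then counted by its
  generating coordinates.\<close>

lemma card_Pi_star:
  assumes w: "w \<in> pair_matched_words k" and k: "k \<ge> 1"
    and m: "m = nat \<lfloor>real n / \<theta>\<rfloor>" "m > 0"
    and bound: "2 * real n < real m * (of_int \<lfloor>2 * \<theta>\<rfloor> + 1)"
  shows "card (Pi_star \<theta> n w) = (\<Sum>\<gamma> \<in> {1..k} \<rightarrow>\<^sub>E A_theta \<theta>. card (generators w n m \<gamma>))"
proof -
  have disj: "\<gamma> = \<delta>" if \<gamma>: "\<gamma> \<in> {1..k} \<rightarrow>\<^sub>E A_theta \<theta>" "\<delta> \<in> {1..k} \<rightarrow>\<^sub>E A_theta \<theta>"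
    and \<pi>: "\<pi> \<in> matched_circuits w n m \<gamma>" "\<pi> \<in> matched_circuits w n m \<delta>" for \<gamma> \<delta> \<pi>
  proof (rule PiE_ext[OF \<gamma>])
    fix a assume "a \<in> {1..k}"
    then obtain j where j: "j \<in> dep_indices w" "a = letter w j"
      using bij_betw_imp_surj_on[OF bij_betw_letter_dep[OF w]] by blast
    then have "(mate w j, j) \<in> matches w" using matches_iff_mate[OF w] by blast
    with \<pi> j have "int m * \<gamma> a = int m * \<delta> a" by (fastforce simp: matched_circuits_def)
    then show "\<gamma> a = \<delta> a" using m(2) by simp
  qed
  have "card (Pi_star \<theta> n w) = (\<Sum>\<gamma> \<in> {1..k} \<rightarrow>\<^sub>E A_theta \<theta>. card (matched_circuits w n m \<gamma>))"
    unfolding Pi_star_eq_UN[OF w m bound]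
  proof (rule card_UN_disjoint)
    show "\<forall>\<gamma>\<in>{1..k} \<rightarrow>\<^sub>E A_theta \<theta>. finite (matched_circuits w n m \<gamma>)"
      by (auto simp: matched_circuits_def finite_circuits)
  qed (use disj in \<open>auto intro: finite_PiE\<close>)
  also have "\<dots> = (\<Sum>\<gamma> \<in> {1..k} \<rightarrow>\<^sub>E A_theta \<theta>. card (generators w n m \<gamma>))"
    using bij_betw_generators[OF w k] by (intro sum.cong refl bij_betw_same_card)
  finally show ?thesis .
qed

section \<open>The limit\<close>

text \<open>After division by \<open>m n\<close> the endpoints 1 and \<open>n\<close> tend to 0 and
  \<open>t\<close>. As \<open>v\<close> is neither limit, all comparisons are eventually decided by
  strict inequalities.\<close>

lemma eventually_between_iff:
  fixes v t :: real
  assumes V: "(\<lambda>n. V n / real (m n)) \<longlonglongrightarrow> v" and T: "(\<lambda>n. real n / real (m n)) \<longlonglongrightarrow> t"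
    and m: "filterlim m at_top sequentially" and v: "v \<noteq> 0" "v \<noteq> t"
  shows "\<forall>\<^sub>F n in sequentially. V n \<in> {1..real n} \<longleftrightarrow> v \<in> {0<..<t}"
proof -
  have pos: "\<forall>\<^sub>F n in sequentially. m n > 0"
    by (rule eventually_compose_filterlim[OF eventually_gt_at_top m])
  have inv: "(\<lambda>n. 1 / real (m n)) \<longlonglongrightarrow> 0"
    by (rule tendsto_divide_0[OF tendsto_const
          filterlim_at_top_imp_at_infinity[OF filterlim_compose[OF filterlim_real_sequentially m]]])
  have lower: "\<forall>\<^sub>F n in sequentially. 1 \<le> V n \<longleftrightarrow> 0 < v"
  proof (cases "0 < v")
    case True
    have "\<forall>\<^sub>F n in sequentially. 0 < V n / real (m n) - 1 / real (m n)"
      using tendsto_diff[OF V inv] True by (intro order_tendstoD(1)[of _ "v - 0"]) auto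
    with pos show ?thesis
      by eventually_elim (use True in \<open>auto simp: field_simps\<close>)
  next
    case False
    with v have "\<forall>\<^sub>F n in sequentially. V n / real (m n) < 0"
      by (intro order_tendstoD(2)[OF V]) auto
    with pos show ?thesis
      by eventually_elim (use False in \<open>auto simp: field_simps\<close>)
  qed
  have upper: "\<forall>\<^sub>F n in sequentially. V n \<le> real n \<longleftrightarrow> v < t"
  proof (cases "v < t")
    case True
    have "\<forall>\<^sub>F n in sequentially. 0 < real n / real (m n) - V n / real (m n)"
      using tendsto_diff[OF T V] True by (intro order_tendstoD(1)[of _ "t - v"]) auto
    with pos show ?thesis
      by eventually_elim (use True in \<open>auto simp: field_simps\<close>)
  next
    case False
    with v have "\<forall>\<^sub>F n in sequentially. 0 < V n / real (m n) - real n / real (m n)"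
      using tendsto_diff[OF V T] by (intro order_tendstoD(1)[of _ "v - t"]) auto
    with pos show ?thesis
      by eventually_elim (use False in \<open>auto simp: field_simps\<close>)
  qed
  from lower upper show ?thesis by eventually_elim auto
qed

text \<open>Dividing \<open>solution\<close> by the modulus gives the same form at the rescaled
  lattice point plus \<open>shift\<close>, and a finite linear combination is continuous.\<close>

lemma solution_ceil_grid_tendsto:
  assumes m: "filterlim m at_top sequentially" and j: "j \<le> length w"
    and x: "\<And>i. i \<in> gen_indices w \<Longrightarrow> x i \<ge> 0"
  shows "(\<lambda>n. solution w (m n) \<gamma> j (ceil_grid (gen_indices w) (m n) x) / real (m n))
    \<longlonglongrightarrow> lin_H w j x + of_int (shift w j \<gamma>)"
proof -
  define c where "c i = lin_H w j (\<lambda>l. of_bool (l = i))" for i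
  have L: "lin_H w j \<nu> = (\<Sum>i\<in>gen_indices w. c i * \<nu> i)" for \<nu>
    unfolding c_def by (rule lin_H_eq_sum[OF j])
  have "(\<lambda>n. lin_H w j (\<lambda>i. real (ceil_grid (gen_indices w) (m n) x i) / real (m n))
      + of_int (shift w j \<gamma>)) \<longlonglongrightarrow> lin_H w j x + of_int (shift w j \<gamma>)"
    unfolding L
    by (intro tendsto_intros ceil_grid_tendsto m x)
  then show ?thesis
  proof (rule Lim_transform_eventually)
    have "\<forall>\<^sub>F n in sequentially. m n > 0"
      by (rule eventually_compose_filterlim[OF eventually_gt_at_top m])
    then show "\<forall>\<^sub>F n in sequentially.
        lin_H w j (\<lambda>i. real (ceil_grid (gen_indices w) (m n) x i) / real (m n)) + of_int (shift w j \<gamma>)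
        = solution w (m n) \<gamma> j (ceil_grid (gen_indices w) (m n) x) / real (m n)"
      by eventually_elim (simp add: lin_H_divide solution_def add_divide_distrib)
  qed
qed

text \<open>At generating indices \<open>solution\<close> is \<open>p\<close> itself, so the range
  conditions on all indices take one uniform shape.\<close>

lemma generators_iff:
  assumes "p \<in> extensional (gen_indices w)"
  shows "p \<in> generators w n m \<gamma> \<longleftrightarrow>
    (\<forall>j \<in> {0..length w}. solution w m \<gamma> j p \<in> {1..real n}) \<and> real (p 0) = solution w m \<gamma> (length w) p"
proof -
  have "{0..length w} = gen_indices w \<union> dep_indices w"
    using gen_indices_subset[of w] by (auto simp: dep_indices_def)
  moreover have "(\<forall>j\<in>gen_indices w. solution w m \<gamma> j p \<in> {1..real n}) \<longleftrightarrow> p \<in> gen_indices w \<rightarrow>\<^sub>E {1..n}"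
    using assms by (auto simp: solution_gen dep_indices_def PiE_iff)
  ultimately show ?thesis by (auto simp: generators_def)
qed

text \<open>Off the exceptional null sets, membership of the rounded point is eventually constant in
  \<open>n\<close>, not merely convergent: each range condition stabilises by
  \<open>eventually_between_iff\<close>, and the closing equation stabilises in both of its
  cases.\<close>

lemma eventually_ceil_grid_generators_iff:
  assumes m: "filterlim m at_top sequentially" and T: "(\<lambda>n. real n / real (m n)) \<longlonglongrightarrow> \<theta>"
    and ne: "\<And>j. j \<le> length w \<Longrightarrow> lin_H w j x + of_int (shift w j \<gamma>) \<notin> {0, \<theta>}"
    and closing: "(\<forall>\<nu>. lin_H w (length w) \<nu> = \<nu> 0) \<or> x 0 \<noteq> lin_H w (length w) x + of_int (shift w (length w) \<gamma>)"
  shows "\<forall>\<^sub>F n in sequentially. ceil_grid (gen_indices w) (m n) x \<in> generators w n (m n) \<gamma> \<longleftrightarrow>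
    (\<forall>j \<in> {0..length w}. lin_H w j x + of_int (shift w j \<gamma>) \<in> {0<..<\<theta>}) \<and>
    x 0 = lin_H w (length w) x + of_int (shift w (length w) \<gamma>)"
proof (cases "\<forall>i \<in> gen_indices w. x i \<ge> 0")
  case True
  define q where "q n = ceil_grid (gen_indices w) (m n) x" for n
  define V where "V j n = solution w (m n) \<gamma> j (q n)" for j n
  define v where "v j = lin_H w j x + of_int (shift w j \<gamma>)" for j
  have V: "(\<lambda>n. V j n / real (m n)) \<longlonglongrightarrow> v j" if "j \<le> length w" for j
    unfolding V_def v_def q_def using True m that by (intro solution_ceil_grid_tendsto) auto
  have gen: "V 0 n = real (q n 0)" "v 0 = x 0" for n
    by (simp_all add: V_def v_def solution_gen dep_indices_def lin_H.simps shift.simps)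
  have pos: "\<forall>\<^sub>F n in sequentially. m n > 0"
    by (rule eventually_compose_filterlim[OF eventually_gt_at_top m])
  have "\<forall>\<^sub>F n in sequentially. \<forall>j\<in>{0..length w}. V j n \<in> {1..real n} \<longleftrightarrow> v j \<in> {0<..<\<theta>}"
    using ne unfolding v_def[symmetric]
    by (intro eventually_ball_finite ballI eventually_between_iff[OF V T m]) auto
  moreover have "\<forall>\<^sub>F n in sequentially. real (q n 0) = V (length w) n \<longleftrightarrow> x 0 = v (length w)"
    using closing
  proof
    assume id: "\<forall>\<nu>. lin_H w (length w) \<nu> = \<nu> 0"
    show ?thesis
      \<comment> \<open>With the identity, both equations say that \<open>shift\<close> vanishes at
        the last index; the factor \<open>m n\<close> is cancelled by positivity.\<close>
      using pos by eventually_elim (simp add: V_def v_def solution_def id)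
  next
    assume "x 0 \<noteq> lin_H w (length w) x + of_int (shift w (length w) \<gamma>)"
    then have ne0: "x 0 \<noteq> v (length w)" by (simp add: v_def)
    have "(\<lambda>n. V 0 n / real (m n) - V (length w) n / real (m n)) \<longlonglongrightarrow> v 0 - v (length w)"
      by (intro tendsto_diff V) auto
    then have "\<forall>\<^sub>F n in sequentially. V 0 n / real (m n) - V (length w) n / real (m n) \<noteq> 0"
      using ne0 by (intro tendsto_imp_eventually_ne) (auto simp: gen)
    then show ?thesis by eventually_elim (use ne0 in \<open>auto simp: gen\<close>)
  qed
  ultimately show ?thesis
  proof eventually_elim
    case (elim n)
    have "q n \<in> extensional (gen_indices w)" by (simp add: q_def ceil_grid_def)
    then have "q n \<in> generators w n (m n) \<gamma> \<longleftrightarrow>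
        (\<forall>j\<in>{0..length w}. V j n \<in> {1..real n}) \<and> real (q n 0) = V (length w) n"
      unfolding V_def by (rule generators_iff)
    then show ?case using elim by (simp add: q_def v_def)
  qed
next
  case False
  then obtain i where i: "i \<in> gen_indices w" "x i < 0" by force
  \<comment> \<open>A negative generating coordinate makes both sides false: it is rounded to 0,
    which is outside {1..n}, and it is not in the open interval either.\<close>
  have "ceil_grid (gen_indices w) (m n) x i = 0" for n
    using i by (simp add: ceil_grid_def mult_nonneg_nonpos)
  then have "ceil_grid (gen_indices w) (m n) x \<notin> generators w n (m n) \<gamma>" for n
    using i(1) by (force simp: generators_def PiE_iff)
  moreover have "lin_H w i x + of_int (shift w i \<gamma>) \<notin> {0<..<\<theta>}" "i \<in> {0..length w}"
    using i gen_indices_subset[of w] by (auto simp: dep_indices_def lin_H.simps shift.simps)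
  ultimately show ?thesis by auto
qed

lemma card_generators_tendsto:
  assumes w: "w \<in> pair_matched_words k"
    and m: "filterlim m at_top sequentially" and T: "(\<lambda>n. real n / real (m n)) \<longlonglongrightarrow> \<theta>"
  shows "(\<lambda>n. real (card (generators w n (m n) \<gamma>)) / real (m n) ^ (k + 1)) \<longlonglongrightarrow>
    (LINT \<nu> : (gen_indices w \<rightarrow>\<^sub>E {0..\<theta>}) | PiM (gen_indices w) (\<lambda>_. lborel).
            of_bool (\<forall>i \<in> {0..2 * k} - (gen_indices w \<union> {2 * k}).
                       lin_H w i \<nu> + of_int (shift w i \<gamma>) \<in> {0<..<\<theta>}) *
            of_bool (\<nu> 0 = lin_H w (2 * k) \<nu> + of_int (shift w (2 * k) \<gamma>)))"
proof -
  let ?S = "gen_indices w"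
  let ?M = "PiM ?S (\<lambda>_. lborel :: real measure)"
  note len = length_pair_matched[OF w]
  have [measurable]: "lin_H w j \<in> borel_measurable ?M" if "j \<le> 2 * k" for j
    using measurable_lin_H[of j w] that by (simp add: len)
  define f where "f = (\<lambda>\<nu>. indicat_real (?S \<rightarrow>\<^sub>E {0..\<theta>}) \<nu> *\<^sub>R
      (of_bool (\<forall>i \<in> {0..2 * k} - (?S \<union> {2 * k}). lin_H w i \<nu> + of_int (shift w i \<gamma>) \<in> {0<..<\<theta>}) *
       of_bool (\<nu> 0 = lin_H w (2 * k) \<nu> + of_int (shift w (2 * k) \<gamma>))) :: real)"
  have "(\<lambda>n. real (card (generators w n (m n) \<gamma>)) / real (m n) ^ card ?S) \<longlonglongrightarrow> (\<integral>x. f x \<partial>?M)"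
  proof (rule lattice_count_tendsto_integral[where N = "\<lambda>n. n" and B = "\<theta> + 1", OF _ m])
    show "generators w n (m n) \<gamma> \<subseteq> ?S \<rightarrow>\<^sub>E {1..n}" for n
      by (auto simp: generators_def)
    have "\<forall>\<^sub>F n in sequentially. m n > 0"
      by (rule eventually_compose_filterlim[OF eventually_gt_at_top m])
    moreover have "\<forall>\<^sub>F n in sequentially. real n / real (m n) < \<theta> + 1"
      by (rule order_tendstoD(2)[OF T]) simp
    ultimately show "\<forall>\<^sub>F n in sequentially. real n \<le> (\<theta> + 1) * real (m n)"
      by eventually_elim (simp add: field_simps)
    have comp: "(\<lambda>\<nu>. \<nu> i) \<in> borel_measurable ?M" if "i \<in> ?S" for i
      using measurable_component_singleton[OF that, of "\<lambda>_. lborel"] by simp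
    have "?S \<rightarrow>\<^sub>E {0..\<theta>} \<in> sets ?M" by (intro sets_PiM_I_finite) auto
    moreover have "Measurable.pred ?M (\<lambda>\<nu>. \<forall>i \<in> {0..2 * k} - (?S \<union> {2 * k}).
        lin_H w i \<nu> + of_int (shift w i \<gamma>) \<in> {0<..<\<theta>})"
      unfolding greaterThanLessThan_iff
      by (intro pred_intros_finite pred_intros_logic borel_measurable_pred_less
          borel_measurable_add borel_measurable_const) (auto intro!: measurable_lin_H simp: len)
    moreover have "Measurable.pred ?M (\<lambda>\<nu>. \<nu> 0 = lin_H w (2 * k) \<nu> + of_int (shift w (2 * k) \<gamma>))"
      unfolding pred_def
      by (intro borel_measurable_eq borel_measurable_add borel_measurable_const comp) auto
    ultimately show "f \<in> borel_measurable ?M"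
      unfolding f_def by measurable
    have "AE x in ?M. \<forall>j\<in>{0..length w}. lin_H w j x + of_int (shift w j \<gamma>) \<notin> {0, \<theta>}"
    proof (rule AE_finite_allI)
      fix j assume "j \<in> {0..length w}"
      then have j: "j \<le> length w" by simp
      show "AE x in ?M. lin_H w j x + of_int (shift w j \<gamma>) \<notin> {0, \<theta>}"
        using AE_lin_H_neq[OF j, of "- of_int (shift w j \<gamma>)"]
          AE_lin_H_neq[OF j, of "\<theta> - of_int (shift w j \<gamma>)"]
        by eventually_elim (auto simp: field_simps)
    qed simp
    moreover have "AE x in ?M. (\<forall>\<nu>. lin_H w (length w) \<nu> = \<nu> 0) \<or>
        x 0 \<noteq> lin_H w (length w) x + of_int (shift w (length w) \<gamma>)"
      using AE_closing_equation_cases[of "length w" w "of_int (shift w (length w) \<gamma>)"] by auto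
    ultimately show "AE x in ?M. (\<lambda>n. of_bool (ceil_grid ?S (m n) x \<in> generators w n (m n) \<gamma>)) \<longlonglongrightarrow> f x"
      using AE_space
    proof eventually_elim
      case (elim x)
      let ?v = "\<lambda>j. lin_H w j x + of_int (shift w j \<gamma>)"
      have v: "?v j = x j" if "j \<in> ?S" for j
        using that by (simp add: dep_indices_def lin_H.simps shift.simps)
      have ne: "?v j \<noteq> 0" "?v j \<noteq> \<theta>" if "j \<le> 2 * k" for j
        using elim(1) that by (auto simp: len)
      have ext: "x \<in> extensional ?S" using elim(3) by (simp add: space_PiM PiE_iff)
      \<comment> \<open>The closed cube and the open one differ only where some coordinate is 0 or
        \<open>\<theta>\<close>, and these values are excluded here.\<close>
      have S: "x \<in> ?S \<rightarrow>\<^sub>E {0..\<theta>} \<longleftrightarrow> (\<forall>j\<in>?S. ?v j \<in> {0<..<\<theta>})"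
      proof -
        have "x j \<in> {0..\<theta>} \<longleftrightarrow> ?v j \<in> {0<..<\<theta>}" if "j \<in> ?S" for j
          using ne[of j] v[OF that] gen_indices_subset[of w] that by (auto simp: len)
        then show ?thesis using ext by (auto simp: PiE_iff)
      qed
      have "{0..length w} = ?S \<union> ({0..2 * k} - (?S \<union> {2 * k})) \<union> {2 * k}"
        using gen_indices_subset[of w] by (auto simp: len)
      \<comment> \<open>The integrand has no range condition at 2k; it follows from the closing
        equation, which equates that value with \<open>x 0\<close>.\<close>
      moreover have "?v (2 * k) \<in> {0<..<\<theta>}" if "\<forall>j\<in>?S. ?v j \<in> {0<..<\<theta>}" "x 0 = ?v (2 * k)"
        using bspec[OF that(1), of 0] v[of 0] that(2) by simp
      ultimately have fx: "f x = of_bool ((\<forall>j\<in>{0..length w}. ?v j \<in> {0<..<\<theta>}) \<and> x 0 = ?v (length w))"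
        unfolding f_def S indicator_def len by auto
      have "\<forall>\<^sub>F n in sequentially. ceil_grid ?S (m n) x \<in> generators w n (m n) \<gamma> \<longleftrightarrow>
          (\<forall>j\<in>{0..length w}. ?v j \<in> {0<..<\<theta>}) \<and> x 0 = ?v (length w)"
        by (rule eventually_ceil_grid_generators_iff[OF m T]) (use elim(1,2) in auto)
      then have "\<forall>\<^sub>F n in sequentially. of_bool (ceil_grid ?S (m n) x \<in> generators w n (m n) \<gamma>) = f x"
        by eventually_elim (simp only: fx)
      then show ?case by (rule tendsto_eventually)
    qed
  qed simp
  then show ?thesis
    by (simp add: f_def set_lebesgue_integral_def card_gen_indices[OF w])
qed

section \<open>Asymptotics of the modulus and assembly of the limit\<close>

lemma nat_floor_divide_at_top:
  assumes "\<theta> > (0 :: real)"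
  shows "filterlim (\<lambda>n. nat \<lfloor>real n / \<theta>\<rfloor>) at_top sequentially"
proof -
  have "filterlim (\<lambda>n. real n / \<theta>) at_top sequentially"
    using filterlim_tendsto_pos_mult_at_top[OF tendsto_const _ filterlim_real_sequentially, of "1 / \<theta>"] assms
    by simp
  then show ?thesis
    by (rule filterlim_compose[OF filterlim_nat_sequentially filterlim_compose[OF filterlim_floor_sequentially]])
qed

text \<open>From m \<le> n / \<theta> \<le> m + 1 the ratio n / m is squeezed between \<theta> and
  \<theta> + \<theta> / m.\<close>

lemma divide_nat_floor_tendsto:
  assumes \<theta>: "\<theta> > (0 :: real)"
  shows "(\<lambda>n. real n / real (nat \<lfloor>real n / \<theta>\<rfloor>)) \<longlonglongrightarrow> \<theta>"
proof -
  define m where "m n = nat \<lfloor>real n / \<theta>\<rfloor>" for n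
  have m: "filterlim m at_top sequentially"
    unfolding m_def[abs_def] by (rule nat_floor_divide_at_top[OF \<theta>])
  have pos: "\<forall>\<^sub>F n in sequentially. m n > 0"
    by (rule eventually_compose_filterlim[OF eventually_gt_at_top m])
  have inv: "(\<lambda>n. 1 / real (m n)) \<longlonglongrightarrow> 0"
    by (rule tendsto_divide_0[OF tendsto_const
          filterlim_at_top_imp_at_infinity[OF filterlim_compose[OF filterlim_real_sequentially m]]])
  have "(\<lambda>n. real n / real (m n)) \<longlonglongrightarrow> \<theta>"
  proof (rule tendsto_sandwich)
    have bnd: "real (m n) \<le> real n / \<theta>" "real n / \<theta> \<le> real (m n) + 1" if "m n > 0" for n
      using that unfolding m_def by linarith+
    show "\<forall>\<^sub>F n in sequentially. \<theta> \<le> real n / real (m n)"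
      using pos by eventually_elim (use bnd(1) \<theta> in \<open>simp add: field_simps\<close>)
    show "\<forall>\<^sub>F n in sequentially. real n / real (m n) \<le> \<theta> + \<theta> * (1 / real (m n))"
      using pos by eventually_elim (use bnd(2) \<theta> in \<open>simp add: field_simps\<close>)
    show "(\<lambda>n. \<theta> + \<theta> * (1 / real (m n))) \<longlonglongrightarrow> \<theta>"
      using tendsto_add[OF tendsto_const tendsto_mult[OF tendsto_const inv], of \<theta> \<theta>] by simp
  qed simp
  then show ?thesis by (simp only: m_def)
qed

theorem theorem2p1:
  fixes \<theta> :: real and k :: nat and w :: "nat list"
  assumes "\<theta> > 0" and "k \<ge> 1" and "w \<in> pair_matched_words k"
  shows "convergent (scaled_count \<theta> k w) \<and>
    p_theta \<theta> k w =
      (\<Sum>\<gamma> \<in> {1..k} \<rightarrow>\<^sub>E A_theta \<theta>.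
         (1 / \<theta> ^ (k + 1)) *
         (LINT \<nu> : (gen_indices w \<rightarrow>\<^sub>E {0..\<theta>}) | PiM (gen_indices w) (\<lambda>_. lborel).
            of_bool (\<forall>i \<in> {0..2 * k} - (gen_indices w \<union> {2 * k}).
                       lin_H w i \<nu> + of_int (shift w i \<gamma>) \<in> {0<..<\<theta>}) *
            of_bool (\<nu> 0 = lin_H w (2 * k) \<nu> + of_int (shift w (2 * k) \<gamma>))))"
    (is "_ \<and> _ = (\<Sum>\<gamma> \<in> ?G. _ * ?I \<gamma>)")
proof -
  define m where "m n = nat \<lfloor>real n / \<theta>\<rfloor>" for n
  have m: "filterlim m at_top sequentially"
    unfolding m_def[abs_def] by (rule nat_floor_divide_at_top[OF assms(1)])
  have T: "(\<lambda>n. real n / real (m n)) \<longlonglongrightarrow> \<theta>"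
    unfolding m_def by (rule divide_nat_floor_tendsto[OF assms(1)])
  \<comment> \<open>The counts converge when normalised by \<open>m n\<close>; the factor
    \<open>1 / (real n / real (m n)) ^ (k + 1)\<close> changes the normalisation to \<open>n\<close>
    and contributes the power of \<open>\<theta>\<close>.\<close>
  have "(\<lambda>n. \<Sum>\<gamma>\<in>?G. 1 / (real n / real (m n)) ^ (k + 1) *
      (real (card (generators w n (m n) \<gamma>)) / real (m n) ^ (k + 1)))
    \<longlonglongrightarrow> (\<Sum>\<gamma>\<in>?G. 1 / \<theta> ^ (k + 1) * ?I \<gamma>)"
    using assms by (intro tendsto_sum tendsto_mult tendsto_divide tendsto_const tendsto_power T
        card_generators_tendsto[OF assms(3) m T]) simp
  moreover have "\<forall>\<^sub>F n in sequentially. (\<Sum>\<gamma>\<in>?G. 1 / (real n / real (m n)) ^ (k + 1) *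
      (real (card (generators w n (m n) \<gamma>)) / real (m n) ^ (k + 1))) = scaled_count \<theta> k w n"
  proof -
    \<comment> \<open>This strict inequality leaves room for n / m to differ from its limit, which
      yields the bound required by \<open>card_Pi_star\<close> for large \<open>n\<close>.\<close>
    have "2 * \<theta> < of_int \<lfloor>2 * \<theta>\<rfloor> + 1" by linarith
    then have "\<forall>\<^sub>F n in sequentially. 2 * (real n / real (m n)) < of_int \<lfloor>2 * \<theta>\<rfloor> + 1"
      by (rule order_tendstoD(2)[OF tendsto_mult[OF tendsto_const T]])
    moreover have "\<forall>\<^sub>F n in sequentially. m n > 0"
      by (rule eventually_compose_filterlim[OF eventually_gt_at_top m])
    ultimately show ?thesis
    proof eventually_elim
      case (elim n)
      then have "2 * real n < real (m n) * (of_int \<lfloor>2 * \<theta>\<rfloor> + 1)" by (simp add: field_simps)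
      then have "real (card (Pi_star \<theta> n w)) = (\<Sum>\<gamma>\<in>?G. real (card (generators w n (m n) \<gamma>)))"
        using card_Pi_star[OF assms(3,2) m_def] elim(2) by simp
      then show ?case
        using elim(2) by (simp add: scaled_count_def sum_divide_distrib power_divide)
    qed
  qed
  ultimately have "scaled_count \<theta> k w \<longlonglongrightarrow> (\<Sum>\<gamma>\<in>?G. 1 / \<theta> ^ (k + 1) * ?I \<gamma>)"
    by (rule Lim_transform_eventually)
  then show ?thesis
    unfolding p_theta_def by (simp add: convergentI limI)
qed

end
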